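(* Let $1\le p<\infty$, $q\ge 0$ and $L,M>0$. There is a constant $c>0$ depending only on $p$ and $q$ such that for every $n\geq 1$ $$\mathcal{R}_n(\mathcal{P}^q_{L,M})\ge c\,M L^{p-q}n^{-1/2}.$$
   Context: Let $\Omega=\{(t_1,t_2)\in\mathbb{R}^2: t_2>t_1\}$, $\partial\Omega=\{(t,t):t\in\mathbb{R}\}$, $\overline{\Omega}=\Omega\sqcup\partial\Omega$, let $\|\cdot\|$ be the Euclidean norm, and for $x=(t_1,t_2)\in\Omega$ let $\|x-\partial\Omega\|=(t_2-t_1)/\sqrt2$ be the distance from $x$ to $\partial\Omega$. For $1\le p<\infty$ and (non-negative) measures $\mu,\nu$ on $\Omega$, $\mathrm{OT}_p(\mu,\nu)=\inf_{\pi\in\mathrm{Adm}(\mu,\nu)}\big(\iint_{\overline\Omega\times\overline\Omega}\|x-y\|^p\,d\pi(x,y)\big)^{1/p}$, where $\mathrm{Adm}(\mu,\nu)$ is the set of measures on $\overline\Omega\times\overline\Omega$ whose first (resp. second) marginal coincides with $\mu$ (resp. $\nu$) on $\Omega$ (no constraint on $\partial\Omega\times\partial\Omega$). For $q\ge 0$, $\mathrm{Pers}_q(\mu)=\int_\Omega\|x-\partial\Omega\|^q\,d\mu(x)$, and $\mathcal{M}^q$ is the set of non-negative Radon measures $\mu$ on $\Omega$ with $\mathrm{Pers}_q(\mu)<\infty$. Let $A_L$ be the $\ell_1$-ball in $\mathbb{R}^2$ centered at $(-L/\sqrt8,L/\sqrt8)$ of radius $L/\sqrt2$. $\mathcal{M}^q_{L,M}$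 is the set of $\mu\in\mathcal{M}^q$ supported on $A_L$ with $\mathrm{Pers}_q(\mu)\le M$, and $\mathcal{P}^q_{L,M}$ is the set of probability distributions supported on $\mathcal{M}^q_{L,M}$. For a probability distribution $P$ on such measures, the expected persistence diagram $\mathbf{E}(P)$ is the measure on $\Omega$ defined by $\mathbf{E}(P)(A)=\mathbb{E}_{\mu\sim P}[\mu(A)]$ for compact $A\subset\Omega$. For a set $\mathcal{P}$ of such probability distributions, the minimax rate is $$\mathcal{R}_n(\mathcal{P})=\inf_{\hat\mu_n}\sup_{P\in\mathcal{P}}\mathbb{E}\big[\mathrm{OT}_p^p(\hat\mu_n,\mathbf{E}(P))\big],$$ where the infimum is over all estimators $\hat\mu_n$ of $\mathbf{E}(P)$, i.e. all measurable measure-valued functions of an i.i.d. $n$-sample $\mu_1,\dots,\mu_n$ of law $P$. *)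

theory Defs
  imports "HOL-Probability.Probability"
begin

definition Omega :: "(real \<times> real) set" where
  "Omega = {x. snd x > fst x}"

definition bd_Omega :: "(real \<times> real) set" where
  "bd_Omega = {x. snd x = fst x}"

definition cl_Omega :: "(real \<times> real) set" where
  "cl_Omega = Omega \<union> bd_Omega"

definition dist_bd :: "real \<times> real \<Rightarrow> real" where
  "dist_bd x = (snd x - fst x) / sqrt 2"

lemma dist_bd_eq_infdist:
  assumes "x \<in> Omega"
  shows "dist_bd x = infdist x bd_Omega"
proof (rule antisym)
  have lower: "dist_bd x \<le> dist x y" if "y \<in> bd_Omega" for y
  proof -
    define a b where "a = fst x - fst y" and "b = snd x - snd y"
    have "(b - a)\<^sup>2 \<le> 2 * (a\<^sup>2 + b\<^sup>2)"
      using sum_squares_ge_zero[of "a + b" 0] by (simp add: power2_eq_square algebra_simps)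
    then have "\<bar>b - a\<bar> \<le> sqrt 2 * sqrt (a\<^sup>2 + b\<^sup>2)"
      unfolding real_sqrt_mult[symmetric] by (metis real_sqrt_abs real_sqrt_le_mono)
    moreover have "snd x - fst x = b - a"
      using that by (simp add: a_def b_def bd_Omega_def)
    ultimately have "snd x - fst x \<le> sqrt 2 * sqrt (a\<^sup>2 + b\<^sup>2)"
      by linarith
    moreover have "dist x y = sqrt (a\<^sup>2 + b\<^sup>2)"
      by (simp add: dist_prod_def dist_real_def a_def b_def)
    ultimately show ?thesis
      by (simp add: dist_bd_def field_simps)
  qed
  have ne: "bd_Omega \<noteq> {}"
    by (auto simp: bd_Omega_def)
  then show "dist_bd x \<le> infdist x bd_Omega"
    unfolding infdist_notempty[OF ne] by (intro cINF_greatest lower)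
  define m where "m = (fst x + snd x) / 2"
  have "infdist x bd_Omega \<le> dist x (m, m)"
    by (rule infdist_le) (simp add: bd_Omega_def)
  also have "dist x (m, m) = sqrt ((snd x - fst x)\<^sup>2 / 2)"
    unfolding dist_prod_def dist_real_def m_def
    by (rule arg_cong[where f = sqrt]) (simp add: power2_eq_square field_simps)
  also have "\<dots> = dist_bd x"
    using assms by (simp add: dist_bd_def Omega_def real_sqrt_divide)
  finally show "infdist x bd_Omega \<le> dist_bd x" .
qed

definition borel_Omega :: "(real \<times> real) measure" where
  "borel_Omega = restrict_space borel Omega"

definition borel_cl_Omega :: "(real \<times> real) measure" where
  "borel_cl_Omega = restrict_space borel cl_Omega"

text \<open>Real powers on \<open>[0, \<infinity>]\<close>, for exponents \<open>a > 0\<close>.\<close>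

definition epowr :: "ennreal \<Rightarrow> real \<Rightarrow> ennreal" where
  "epowr x a = (if x = \<infinity> then \<infinity> else ennreal (enn2real x powr a))"

definition Adm ::
  "(real \<times> real) measure \<Rightarrow> (real \<times> real) measure \<Rightarrow> ((real \<times> real) \<times> (real \<times> real)) measure set" where
  "Adm \<mu> \<nu> = {\<pi>. sets \<pi> = sets (borel_cl_Omega \<Otimes>\<^sub>M borel_cl_Omega) \<and>
     (\<forall>A\<in>sets borel_Omega. emeasure \<pi> (A \<times> cl_Omega) = emeasure \<mu> A) \<and>
     (\<forall>A\<in>sets borel_Omega. emeasure \<pi> (cl_Omega \<times> A) = emeasure \<nu> A)}"

definition OT :: "real \<Rightarrow> (real \<times> real) measure \<Rightarrow> (real \<times> real) measure \<Rightarrow> ennreal" where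
  "OT p \<mu> \<nu> =
     (INF \<pi>\<in>Adm \<mu> \<nu>. epowr (\<integral>\<^sup>+ (x, y). ennreal (norm (x - y) powr p) \<partial>\<pi>) (1 / p))"

definition Pers :: "real \<Rightarrow> (real \<times> real) measure \<Rightarrow> ennreal" where
  "Pers q \<mu> = (\<integral>\<^sup>+ x. ennreal (dist_bd x powr q) \<partial>\<mu>)"

text \<open>On the open set \<open>Omega\<close> of the plane, Radon measures are exactly the Borel measures that are
  finite on compact sets; regularity is automatic.\<close>

definition radon_Omega :: "(real \<times> real) measure \<Rightarrow> bool" where
  "radon_Omega \<mu> \<longleftrightarrow> sets \<mu> = sets borel_Omega \<and>
     (\<forall>K. compact K \<and> K \<subseteq> Omega \<longrightarrow> emeasure \<mu> K < \<infinity>)"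

definition Mq :: "real \<Rightarrow> (real \<times> real) measure set" where
  "Mq q = {\<mu>. radon_Omega \<mu> \<and> Pers q \<mu> < \<infinity>}"

definition A_ball :: "real \<Rightarrow> (real \<times> real) set" where
  "A_ball L = {x. \<bar>fst x - (- (L / sqrt 8))\<bar> + \<bar>snd x - L / sqrt 8\<bar> \<le> L / sqrt 2}"

definition MqLM :: "real \<Rightarrow> real \<Rightarrow> real \<Rightarrow> (real \<times> real) measure set" where
  "MqLM q L M = {\<mu>\<in>Mq q. emeasure \<mu> (Omega - A_ball L) = 0 \<and> Pers q \<mu> \<le> ennreal M}"

text \<open>The space of all Borel measures on \<open>Omega\<close>, with the \<open>\<sigma>\<close>-algebra generated by the
  evaluations \<open>\<mu> \<mapsto> \<mu>(A)\<close> (as in \<^const>\<open>subprob_algebra\<close>, without the mass constraint). On Radon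
  measures it induces the Borel \<open>\<sigma>\<close>-algebra of the vague topology.\<close>

definition measure_algebra :: "(real \<times> real) measure measure" where
  "measure_algebra =
     (SUP A\<in>sets borel_Omega.
        vimage_algebra {\<mu>. sets \<mu> = sets borel_Omega} (\<lambda>\<mu>. emeasure \<mu> A) borel)"

definition PqLM :: "real \<Rightarrow> real \<Rightarrow> real \<Rightarrow> (real \<times> real) measure measure set" where
  "PqLM q L M = {P. prob_space P \<and> sets P = sets measure_algebra \<and> (AE \<mu> in P. \<mu> \<in> MqLM q L M)}"

text \<open>\<open>E(P)\<close> is given by its values on all Borel sets; for \<open>P\<close> in \<^const>\<open>PqLM\<close> it is finite on
  compact sets, hence determined by its values on them.\<close>

definition expected_diagram :: "(real \<times> real) measure measure \<Rightarrow> (real \<times> real) measure" where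
  "expected_diagram P =
     measure_of Omega (sets borel_Omega) (\<lambda>A. \<integral>\<^sup>+ \<mu>. emeasure \<mu> A \<partial>P)"

lemma space_measure_algebra: "space measure_algebra = {\<mu>. sets \<mu> = sets borel_Omega}"
  by (auto simp: measure_algebra_def space_Sup_eq_UN)

lemma measurable_emeasure_measure_algebra:
  "A \<in> sets borel_Omega \<Longrightarrow> (\<lambda>\<mu>. emeasure \<mu> A) \<in> borel_measurable measure_algebra"
  by (auto intro!: measurable_Sup1 measurable_vimage_algebra1 simp: measure_algebra_def)

lemma space_borel_Omega: "space borel_Omega = Omega"
  by (simp add: borel_Omega_def space_restrict_space)

lemma sets_expected_diagram: "sets (expected_diagram P) = sets borel_Omega"
  unfolding expected_diagram_def
  by (metis sets.sets_measure_of_eq space_borel_Omega)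

lemma emeasure_expected_diagram:
  assumes P: "sets P = sets measure_algebra" and A: "A \<in> sets borel_Omega"
  shows "emeasure (expected_diagram P) A = (\<integral>\<^sup>+ \<mu>. emeasure \<mu> A \<partial>P)"
proof (rule emeasure_measure_of[OF expected_diagram_def])
  have meas: "(\<lambda>\<mu>. emeasure \<mu> B) \<in> borel_measurable P" if "B \<in> sets borel_Omega" for B
    using measurable_emeasure_measure_algebra[OF that] measurable_cong_sets[OF P refl] by blast
  show "countably_additive (sets (expected_diagram P)) (\<lambda>A. \<integral>\<^sup>+ \<mu>. emeasure \<mu> A \<partial>P)"
  proof (rule countably_additiveI)
    fix B :: "nat \<Rightarrow> (real \<times> real) set"
    assume "range B \<subseteq> sets (expected_diagram P)" and disj: "disjoint_family B"
    then have B: "range B \<subseteq> sets borel_Omega"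
      by (simp add: sets_expected_diagram)
    then have "(\<Sum>i. \<integral>\<^sup>+ \<mu>. emeasure \<mu> (B i) \<partial>P) = (\<integral>\<^sup>+ \<mu>. (\<Sum>i. emeasure \<mu> (B i)) \<partial>P)"
      by (subst nn_integral_suminf) (auto intro: meas)
    also have "\<dots> = (\<integral>\<^sup>+ \<mu>. emeasure \<mu> (\<Union>i. B i) \<partial>P)"
    proof (rule nn_integral_cong)
      fix \<mu> assume "\<mu> \<in> space P"
      then have "sets \<mu> = sets borel_Omega"
        using sets_eq_imp_space_eq[OF P] by (simp add: space_measure_algebra)
      then show "(\<Sum>i. emeasure \<mu> (B i)) = emeasure \<mu> (\<Union>i. B i)"
        using B disj by (simp add: suminf_emeasure)
    qed
    finally show "(\<Sum>i. \<integral>\<^sup>+ \<mu>. emeasure \<mu> (B i) \<partial>P) = (\<integral>\<^sup>+ \<mu>. emeasure \<mu> (\<Union>i. B i) \<partial>P)" .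
  qed
  show "sets borel_Omega \<subseteq> Pow Omega"
    using sets.space_closed[of borel_Omega] by (simp add: space_borel_Omega)
qed (use A in \<open>auto simp: sets_expected_diagram positive_def\<close>)

definition estimators :: "nat \<Rightarrow> ((nat \<Rightarrow> (real \<times> real) measure) \<Rightarrow> (real \<times> real) measure) set" where
  "estimators n = measurable (\<Pi>\<^sub>M i\<in>{..<n}. measure_algebra) measure_algebra"

definition minimax_rate :: "real \<Rightarrow> nat \<Rightarrow> (real \<times> real) measure measure set \<Rightarrow> ennreal" where
  "minimax_rate p n \<P> =
     (INF est\<in>estimators n. SUP P\<in>\<P>.
        \<integral>\<^sup>+ \<mu>s. epowr (OT p (est \<mu>s) (expected_diagram P)) p \<partial>(\<Pi>\<^sub>M i\<in>{..<n}. P))"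

end

theory Submission
  imports Defs
begin

text \<open>The lower bound holds because of a single unknown weight. Let \<open>x\<close> be the centre of the ball
  \<open>A_L\<close>, at distance \<open>d = L / 2\<close> from the diagonal, and let \<open>m = M / d\<^sup>q\<close>, the largest mass
  that a diagram with its only point at \<open>x\<close> may have. A random diagram that is \<open>m \<delta>\<^sub>x\<close> or
  empty, according to a coin with success probability \<open>\<theta>\<close>, has expected diagram \<open>\<theta> m \<delta>\<^sub>x\<close>.
  Estimating it requires estimating \<open>\<theta>\<close>, which \<open>n\<close> tosses allow only up to an error of order
  \<open>n\<^bsup>-1/2\<^esup>\<close>.

  Two facts make this precise. First, the transport cost controls the error on the weight: with
  \<open>T\<close> the mass that \<open>\<mu>\<close> gives to the ball of radius \<open>d / 2\<close> around \<open>x\<close>, the cost of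
  transporting \<open>\<mu>\<close> to \<open>a \<delta>\<^sub>x\<close> is at least \<open>(d / 2)\<^sup>p \<bar>T - a\<bar>\<close>. Mass
  in excess has to travel from the ball to the diagonal (\<open>OT_point_mass_ge_excess\<close>), missing mass has
  to come from outside the ball (\<open>OT_ge_deficit\<close>), and each of these trips has length at least
  \<open>d / 2\<close>. Since \<open>T\<close> is the evaluation of \<open>\<mu>\<close> at a fixed Borel set, it is a measurable
  function of the sample when \<open>\<mu>\<close> is an estimator, whether or not the cost itself is.

  Second, Le Cam's two-point method (\<open>nn_integral_two_point_lower_bound\<close>): for \<open>\<theta> = 1/2\<close> and
  \<open>\<theta> = 1/2 + \<epsilon>\<close> with \<open>\<epsilon> = 1 / (4 \<surd>n)\<close>, the likelihood ratio of the two laws of the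
  sample has second moment \<open>(1 + 4 \<epsilon>\<^sup>2)\<^sup>n \<le> 2\<close>, so the laws overlap enough for one of the
  two mean errors to be at least a quarter of the separation. The separation of the two expected
  diagrams is \<open>(d / 2)\<^sup>p m \<epsilon>\<close>, which is \<open>M L\<^bsup>p - q\<^esup> n\<^bsup>-1/2\<^esup>\<close> up to a factor that depends on
  \<open>p\<close> and \<open>q\<close> only.\<close>

section \<open>Two hypotheses that \<open>n\<close> observations cannot separate\<close>

text \<open>The likelihood ratio of independent observations is the product of the individual ratios:
  both measures agree on boxes, by Tonelli.\<close>

lemma PiM_density:
  fixes f :: "'i \<Rightarrow> 'a \<Rightarrow> ennreal"
  assumes I: "finite I" and M: "product_sigma_finite M"
    and M': "product_sigma_finite (\<lambda>i. density (M i) (f i))"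
    and f: "\<And>i. i \<in> I \<Longrightarrow> f i \<in> borel_measurable (M i)"
  shows "PiM I (\<lambda>i. density (M i) (f i)) = density (PiM I M) (\<lambda>x. \<Prod>i\<in>I. f i (x i))"
    (is "_ = density _ ?F")
proof (rule sym, rule product_sigma_finite.PiM_eqI[OF M' I])
  interpret product_sigma_finite M by (rule M)
  have meas: "?F \<in> borel_measurable (PiM I M)"
    using f by measurable
  show "sets (density (PiM I M) ?F) = sets (PiM I (\<lambda>i. density (M i) (f i)))"
    by (simp cong: sets_PiM_cong)
  fix A assume "\<And>i. i \<in> I \<Longrightarrow> A i \<in> sets (density (M i) (f i))"
  then have A: "\<And>i. i \<in> I \<Longrightarrow> A i \<in> sets (M i)"
    by simp
  have "emeasure (density (PiM I M) ?F) (Pi\<^sub>E I A)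
      = (\<integral>\<^sup>+ x. ?F x * indicator (Pi\<^sub>E I A) x \<partial>PiM I M)"
    using meas sets_PiM_I_finite[OF I A] by (simp add: emeasure_density)
  also have "\<dots> = (\<integral>\<^sup>+ x. (\<Prod>i\<in>I. f i (x i) * indicator (A i) (x i)) \<partial>PiM I M)"
  proof (rule nn_integral_cong)
    fix x assume "x \<in> space (PiM I M)"
    then have "indicator (Pi\<^sub>E I A) x = (\<Prod>i\<in>I. indicator (A i) (x i) :: ennreal)"
      using I by (auto simp: indicator_def space_PiM PiE_iff prod.If_cases)
    then show "?F x * indicator (Pi\<^sub>E I A) x = (\<Prod>i\<in>I. f i (x i) * indicator (A i) (x i))"
      by (simp add: prod.distrib)
  qed
  also have "\<dots> = (\<Prod>i\<in>I. \<integral>\<^sup>+ y. f i y * indicator (A i) y \<partial>M i)"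
    using f A by (intro product_nn_integral_prod[OF I]) auto
  also have "\<dots> = (\<Prod>i\<in>I. emeasure (density (M i) (f i)) (A i))"
    using f A by (intro prod.cong refl) (simp add: emeasure_density)
  finally show "emeasure (density (PiM I M) ?F) (Pi\<^sub>E I A)
      = (\<Prod>i\<in>I. emeasure (density (M i) (f i)) (A i))" .
qed

text \<open>From \<open>(1 - t / 2)\<^sup>2 \<ge> 0\<close>. Applied to the likelihood ratio \<open>t\<close> of two laws, it bounds their
  overlap, the integral of \<open>min 1 t\<close>, from below through the second moment of \<open>t\<close>.\<close>

lemma ennreal_le_min_one_plus_square:
  fixes t :: ennreal
  shows "t \<le> min 1 t + t\<^sup>2 / 4"
proof (cases "t \<le> 1")
  case False
  show ?thesis
  proof (cases t)
    case (real r)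
    have "r \<le> 1 + r\<^sup>2 / 4"
      using zero_le_power2[of "1 - r / 2"] by (simp add: power2_eq_square algebra_simps)
    then have "ennreal r \<le> ennreal (1 + r\<^sup>2 / 4)"
      by (rule ennreal_leI)
    also have "\<dots> = 1 + (ennreal r)\<^sup>2 / 4"
      using real by (simp add: ennreal_plus ennreal_power flip: divide_ennreal)
    finally show ?thesis
      using False real by (simp add: min_def)
  next
    case top
    then show ?thesis
      by (simp add: power2_eq_square ennreal_top_mult ennreal_top_divide)
  qed
qed (simp add: min_def)

text \<open>Le Cam's two-point bound. The hypothesis \<open>sep\<close> says that no outcome \<open>\<omega>\<close> makes both losses
  small. With \<open>F\<close> the likelihood ratio of the two samples, the sum of the two risks is the integral
  of \<open>g\<^sub>0 + F g\<^sub>1 \<ge> \<Delta> min 1 F\<close> against the law of the first sample, and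
  \<open>\<integral> min 1 F \<ge> \<integral> F - \<integral> F\<^sup>2 / 4 \<ge> 1 - 2 / 4\<close>. Working with \<open>min 1 F\<close> through
  this quadratic minorant needs only second moments, which factorize over the sample.\<close>

lemma nn_integral_two_point_lower_bound:
  fixes Q :: "'a measure" and f :: "'a \<Rightarrow> ennreal" and g\<^sub>0 g\<^sub>1 :: "(nat \<Rightarrow> 'a) \<Rightarrow> ennreal"
  assumes Q: "prob_space Q" and f [measurable]: "f \<in> borel_measurable Q"
    and f1: "(\<integral>\<^sup>+ x. f x \<partial>Q) = 1"
    and f2: "(\<integral>\<^sup>+ x. (f x)\<^sup>2 \<partial>Q) ^ n \<le> 2"
    and g [measurable]: "g\<^sub>0 \<in> borel_measurable (\<Pi>\<^sub>M i\<in>{..<n}. Q)"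
      "g\<^sub>1 \<in> borel_measurable (\<Pi>\<^sub>M i\<in>{..<n}. Q)"
    and sep: "\<And>\<omega>. \<omega> \<in> space (\<Pi>\<^sub>M i\<in>{..<n}. Q) \<Longrightarrow> \<Delta> \<le> g\<^sub>0 \<omega> + g\<^sub>1 \<omega>"
  shows "\<Delta> / 2 \<le> (\<integral>\<^sup>+ \<omega>. g\<^sub>0 \<omega> \<partial>(\<Pi>\<^sub>M i\<in>{..<n}. Q)) + (\<integral>\<^sup>+ \<omega>. g\<^sub>1 \<omega> \<partial>(\<Pi>\<^sub>M i\<in>{..<n}. density Q f))"
proof -
  interpret Q: prob_space Q by (rule Q)
  interpret QQ: product_prob_space "\<lambda>i::nat. Q" by unfold_locales
  define R where "R = (\<Pi>\<^sub>M i\<in>{..<n}. Q)"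
  define F where "F = (\<lambda>\<omega>::nat \<Rightarrow> 'a. \<Prod>i<n. f (\<omega> i))"
  have F [measurable]: "F \<in> borel_measurable R"
    unfolding F_def R_def by measurable
  have g' [measurable]: "g\<^sub>0 \<in> borel_measurable R" "g\<^sub>1 \<in> borel_measurable R"
    using g by (simp_all add: R_def)
  have "emeasure (density Q f) (space (density Q f)) = 1"
    using f1 by (simp add: emeasure_density nn_integral_set_ennreal cong: nn_integral_cong_simp)
  then interpret P: prob_space "density Q f"
    by (rule prob_spaceI)
  interpret PP: product_prob_space "\<lambda>i::nat. density Q f" by unfold_locales
  have PF: "(\<Pi>\<^sub>M i\<in>{..<n}. density Q f) = density R F"
    unfolding R_def F_def
    by (rule PiM_density) (auto intro: QQ.product_sigma_finite_axioms PP.product_sigma_finite_axioms)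
  have F1: "(\<integral>\<^sup>+ \<omega>. F \<omega> \<partial>R) = 1"
    unfolding F_def R_def by (subst QQ.product_nn_integral_prod) (auto simp: f1)
  have F2: "(\<integral>\<^sup>+ \<omega>. (F \<omega>)\<^sup>2 \<partial>R) \<le> 2"
    unfolding F_def R_def prod_power_distrib
    by (subst QQ.product_nn_integral_prod) (auto simp: f2)
  have "1 = (\<integral>\<^sup>+ \<omega>. F \<omega> \<partial>R)"
    by (rule F1[symmetric])
  also have "\<dots> \<le> (\<integral>\<^sup>+ \<omega>. min 1 (F \<omega>) + (F \<omega>)\<^sup>2 / 4 \<partial>R)"
    by (intro nn_integral_mono ennreal_le_min_one_plus_square)
  also have "\<dots> = (\<integral>\<^sup>+ \<omega>. min 1 (F \<omega>) \<partial>R) + (\<integral>\<^sup>+ \<omega>. (F \<omega>)\<^sup>2 \<partial>R) / 4"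
    by (subst nn_integral_add) (auto simp: nn_integral_divide)
  also have "\<dots> \<le> (\<integral>\<^sup>+ \<omega>. min 1 (F \<omega>) \<partial>R) + 2 / 4"
    using F2 by (intro add_left_mono divide_right_mono_ennreal)
  also have "(2::ennreal) / 4 = ennreal (1 / 2)"
    using divide_ennreal[of 2 4] by simp
  finally have "1 - ennreal (1 / 2) \<le> (\<integral>\<^sup>+ \<omega>. min 1 (F \<omega>) \<partial>R)"
    by (subst ennreal_minus_le_iff) (auto simp: add.commute)
  moreover have "1 - ennreal (1 / 2) = 1 / 2"
    using ennreal_minus[of "1 / 2" 1] divide_ennreal[of 1 2] by simp
  ultimately have "\<Delta> * (1 / 2) \<le> \<Delta> * (\<integral>\<^sup>+ \<omega>. min 1 (F \<omega>) \<partial>R)"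
    by (intro mult_left_mono) auto
  also have "\<dots> = (\<integral>\<^sup>+ \<omega>. \<Delta> * min 1 (F \<omega>) \<partial>R)"
    by (rule nn_integral_cmult[symmetric]) measurable
  also have "\<dots> \<le> (\<integral>\<^sup>+ \<omega>. g\<^sub>0 \<omega> + F \<omega> * g\<^sub>1 \<omega> \<partial>R)"
  proof (rule nn_integral_mono)
    fix \<omega> assume "\<omega> \<in> space R"
    then have "\<Delta> * min 1 (F \<omega>) \<le> (g\<^sub>0 \<omega> + g\<^sub>1 \<omega>) * min 1 (F \<omega>)"
      using sep by (intro mult_right_mono) (auto simp: R_def)
    also have "\<dots> = g\<^sub>0 \<omega> * min 1 (F \<omega>) + g\<^sub>1 \<omega> * min 1 (F \<omega>)"
      by (rule distrib_right)
    also have "\<dots> \<le> g\<^sub>0 \<omega> * 1 + g\<^sub>1 \<omega> * F \<omega>"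
      by (intro add_mono mult_left_mono) auto
    finally show "\<Delta> * min 1 (F \<omega>) \<le> g\<^sub>0 \<omega> + F \<omega> * g\<^sub>1 \<omega>"
      by (simp add: mult.commute)
  qed
  also have "\<dots> = (\<integral>\<^sup>+ \<omega>. g\<^sub>0 \<omega> \<partial>R) + (\<integral>\<^sup>+ \<omega>. F \<omega> * g\<^sub>1 \<omega> \<partial>R)"
    by (rule nn_integral_add) measurable
  also have "(\<integral>\<^sup>+ \<omega>. F \<omega> * g\<^sub>1 \<omega> \<partial>R) = (\<integral>\<^sup>+ \<omega>. g\<^sub>1 \<omega> \<partial>(\<Pi>\<^sub>M i\<in>{..<n}. density Q f))"
    unfolding PF by (rule nn_integral_density[symmetric]) measurable
  finally show ?thesis
    by (simp add: R_def ennreal_times_divide)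
qed

section \<open>Transport to a point mass\<close>

lemma epowr_mono: "0 < a \<Longrightarrow> x \<le> y \<Longrightarrow> epowr x a \<le> epowr y a"
  by (auto simp: epowr_def top_unique less_top intro!: ennreal_leI powr_mono2 enn2real_mono)

lemma epowr_epowr_inverse: "0 < p \<Longrightarrow> epowr (epowr x (1 / p)) p = x"
  by (cases x) (auto simp: epowr_def powr_powr)

text \<open>A bound on the cost of every admissible plan passes to the infimum, which is taken over the
  \<open>p\<close>-th roots of the costs.\<close>

lemma le_epowr_OT:
  assumes "0 < p"
    and "\<And>\<pi>. \<pi> \<in> Adm \<mu> \<nu> \<Longrightarrow> K \<le> (\<integral>\<^sup>+ (x, y). ennreal (norm (x - y) powr p) \<partial>\<pi>)"
  shows "K \<le> epowr (OT p \<mu> \<nu>) p"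
proof -
  have "epowr K (1 / p) \<le> OT p \<mu> \<nu>"
    unfolding OT_def using assms by (intro INF_greatest epowr_mono) auto
  then have "epowr (epowr K (1 / p)) p \<le> epowr (OT p \<mu> \<nu>) p"
    by (rule epowr_mono[OF \<open>0 < p\<close>])
  then show ?thesis
    using assms by (simp add: epowr_epowr_inverse)
qed

lemma transport_cost_ge:
  assumes \<pi>: "sets \<pi> = sets (borel_cl_Omega \<Otimes>\<^sub>M borel_cl_Omega)"
    and A: "A \<in> sets borel_cl_Omega" and B: "B \<in> sets borel_cl_Omega"
    and r: "\<And>y z. y \<in> A \<Longrightarrow> z \<in> B \<Longrightarrow> r \<le> dist y z" and "0 \<le> r" "0 \<le> p"
  shows "ennreal (r powr p) * emeasure \<pi> (A \<times> B)
    \<le> (\<integral>\<^sup>+ (x, y). ennreal (norm (x - y) powr p) \<partial>\<pi>)"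
proof -
  have "A \<times> B \<in> sets \<pi>"
    using A B by (simp add: \<pi>)
  then have "ennreal (r powr p) * emeasure \<pi> (A \<times> B)
      = (\<integral>\<^sup>+ u. ennreal (r powr p) * indicator (A \<times> B) u \<partial>\<pi>)"
    by (simp add: nn_integral_cmult_indicator)
  also have "\<dots> \<le> (\<integral>\<^sup>+ (x, y). ennreal (norm (x - y) powr p) \<partial>\<pi>)"
    using r assms(5,6)
    by (intro nn_integral_mono)
      (auto simp: indicator_def dist_norm intro!: ennreal_leI powr_mono2)
  finally show ?thesis .
qed

lemma Omega_in_borel [measurable]: "Omega \<in> sets borel"
  unfolding Omega_def by (intro borel_open open_Collect_less continuous_intros)

lemma bd_Omega_in_borel [measurable]: "bd_Omega \<in> sets borel"
  unfolding bd_Omega_def by (intro borel_closed closed_Collect_eq continuous_intros)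

lemma cl_Omega_in_borel [measurable]: "cl_Omega \<in> sets borel"
  unfolding cl_Omega_def by measurable

lemma sets_borel_Omega_iff: "A \<in> sets borel_Omega \<longleftrightarrow> A \<subseteq> Omega \<and> A \<in> sets borel"
  by (auto simp: borel_Omega_def sets_restrict_space_iff)

lemma sets_borel_cl_Omega_iff: "A \<in> sets borel_cl_Omega \<longleftrightarrow> A \<subseteq> cl_Omega \<and> A \<in> sets borel"
  by (auto simp: borel_cl_Omega_def sets_restrict_space_iff)

lemma dist_bd_le_dist: "x \<in> Omega \<Longrightarrow> z \<in> bd_Omega \<Longrightarrow> dist_bd x \<le> dist x z"
  by (simp add: dist_bd_eq_infdist infdist_le)

lemma dist_bd_pos: "x \<in> Omega \<Longrightarrow> 0 < dist_bd x"
  by (simp add: dist_bd_def Omega_def)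

lemma half_ball_in_borel_Omega:
  "ball x (dist_bd x / 2) \<inter> Omega \<in> sets borel_Omega"
  by (auto simp: sets_borel_Omega_iff)

text \<open>A target concentrated at \<open>x\<close> can absorb only \<open>\<nu>{x}\<close> of the mass that leaves the half-way
  ball around \<open>x\<close>; the rest must go to the diagonal, which is at distance at least
  \<open>dist_bd x / 2\<close> from the ball. A ball smaller than the full distance is essential here: mass near
  the diagonal is removed at almost no cost.\<close>

lemma OT_point_mass_ge_excess:
  assumes "0 < p" and x: "x \<in> Omega"
    and \<nu>: "emeasure \<nu> (Omega - {x}) = 0" "emeasure \<nu> {x} \<noteq> \<infinity>"
  shows "ennreal ((dist_bd x / 2) powr p)
      * (emeasure \<mu> (ball x (dist_bd x / 2) \<inter> Omega) - emeasure \<nu> {x}) \<le> epowr (OT p \<mu> \<nu>) p"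
proof (rule le_epowr_OT[OF \<open>0 < p\<close>])
  let ?B = "ball x (dist_bd x / 2) \<inter> Omega"
  fix \<pi> assume "\<pi> \<in> Adm \<mu> \<nu>"
  then have \<pi>: "sets \<pi> = sets (borel_cl_Omega \<Otimes>\<^sub>M borel_cl_Omega)"
    and fst_marginal: "\<And>A. A \<in> sets borel_Omega \<Longrightarrow> emeasure \<pi> (A \<times> cl_Omega) = emeasure \<mu> A"
    and snd_marginal: "\<And>A. A \<in> sets borel_Omega \<Longrightarrow> emeasure \<pi> (cl_Omega \<times> A) = emeasure \<nu> A"
    by (auto simp: Adm_def)
  have [simp]: "A \<times> C \<in> sets \<pi>" if "A \<subseteq> cl_Omega" "A \<in> sets borel" "C \<subseteq> cl_Omega" "C \<in> sets borel" for A C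
    using that unfolding \<pi> by (intro pair_measureI) (auto simp: sets_borel_cl_Omega_iff)
  have sub: "?B \<subseteq> cl_Omega" "Omega - {x} \<subseteq> cl_Omega" "{x} \<subseteq> cl_Omega" "bd_Omega \<subseteq> cl_Omega" "x \<in> cl_Omega"
    using x by (auto simp: cl_Omega_def)
  have [measurable]: "?B \<in> sets borel" "{x} \<in> sets borel" "Omega - {x} \<in> sets borel"
    by auto
  have "emeasure \<mu> ?B = emeasure \<pi> (?B \<times> cl_Omega)"
    by (rule fst_marginal[symmetric]) (rule half_ball_in_borel_Omega)
  also have "\<dots> \<le> emeasure \<pi> (cl_Omega \<times> {x} \<union> (cl_Omega \<times> (Omega - {x}) \<union> ?B \<times> bd_Omega))"
    using x sub by (intro emeasure_mono sets.Un) (auto simp: cl_Omega_def)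
  also have "\<dots> \<le> emeasure \<pi> (cl_Omega \<times> {x})
      + (emeasure \<pi> (cl_Omega \<times> (Omega - {x})) + emeasure \<pi> (?B \<times> bd_Omega))"
    using sub by (intro order_trans[OF emeasure_subadditive] add_left_mono emeasure_subadditive sets.Un) auto
  also have "\<dots> = emeasure \<nu> {x} + emeasure \<pi> (?B \<times> bd_Omega)"
    using x by (simp add: snd_marginal sets_borel_Omega_iff \<nu>)
  finally have "emeasure \<mu> ?B - emeasure \<nu> {x} \<le> emeasure \<pi> (?B \<times> bd_Omega)"
    using \<nu> by (simp add: ennreal_minus_le_iff)
  then have "ennreal ((dist_bd x / 2) powr p) * (emeasure \<mu> ?B - emeasure \<nu> {x})
      \<le> ennreal ((dist_bd x / 2) powr p) * emeasure \<pi> (?B \<times> bd_Omega)"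
    by (rule mult_left_mono) simp
  also have "\<dots> \<le> (\<integral>\<^sup>+ (y, z). ennreal (norm (y - z) powr p) \<partial>\<pi>)"
  proof (rule transport_cost_ge[OF \<pi>])
    fix y z assume "y \<in> ?B" "z \<in> bd_Omega"
    then show "dist_bd x / 2 \<le> dist y z"
      using dist_bd_le_dist[OF x, of z] dist_triangle[of x z y] by (simp add: field_simps)
  qed (use dist_bd_pos[OF x] \<open>0 < p\<close> sub in \<open>auto simp: sets_borel_cl_Omega_iff\<close>)
  finally show "ennreal ((dist_bd x / 2) powr p) * (emeasure \<mu> ?B - emeasure \<nu> {x})
      \<le> (\<integral>\<^sup>+ (y, z). ennreal (norm (y - z) powr p) \<partial>\<pi>)" .
qed

text \<open>The mass at \<open>x\<close> that the half-way ball cannot supply comes from points of the closed half-plane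
  outside the ball, possibly on the diagonal.\<close>

lemma OT_ge_deficit:
  assumes "0 < p" and x: "x \<in> Omega" and \<nu>: "emeasure \<nu> {x} \<noteq> \<infinity>"
  shows "ennreal ((dist_bd x / 2) powr p)
      * (emeasure \<nu> {x} - emeasure \<mu> (ball x (dist_bd x / 2) \<inter> Omega)) \<le> epowr (OT p \<mu> \<nu>) p"
proof (rule le_epowr_OT[OF \<open>0 < p\<close>])
  let ?B = "ball x (dist_bd x / 2) \<inter> Omega"
  fix \<pi> assume "\<pi> \<in> Adm \<mu> \<nu>"
  then have \<pi>: "sets \<pi> = sets (borel_cl_Omega \<Otimes>\<^sub>M borel_cl_Omega)"
    and fst_marginal: "\<And>A. A \<in> sets borel_Omega \<Longrightarrow> emeasure \<pi> (A \<times> cl_Omega) = emeasure \<mu> A"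
    and snd_marginal: "\<And>A. A \<in> sets borel_Omega \<Longrightarrow> emeasure \<pi> (cl_Omega \<times> A) = emeasure \<nu> A"
    by (auto simp: Adm_def)
  have [simp]: "A \<times> C \<in> sets \<pi>" if "A \<subseteq> cl_Omega" "A \<in> sets borel" "C \<subseteq> cl_Omega" "C \<in> sets borel" for A C
    using that unfolding \<pi> by (intro pair_measureI) (auto simp: sets_borel_cl_Omega_iff)
  have sub: "?B \<subseteq> cl_Omega" "cl_Omega - ?B \<subseteq> cl_Omega" "{x} \<subseteq> cl_Omega" "x \<in> cl_Omega"
    using x by (auto simp: cl_Omega_def)
  have [measurable]: "?B \<in> sets borel" "{x} \<in> sets borel" "cl_Omega - ?B \<in> sets borel"
    by auto
  have "emeasure \<nu> {x} = emeasure \<pi> (cl_Omega \<times> {x})"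
    using x by (intro snd_marginal[symmetric]) (simp add: sets_borel_Omega_iff)
  also have "\<dots> \<le> emeasure \<pi> (?B \<times> cl_Omega \<union> (cl_Omega - ?B) \<times> {x})"
    using sub by (intro emeasure_mono sets.Un) auto
  also have "\<dots> \<le> emeasure \<pi> (?B \<times> cl_Omega) + emeasure \<pi> ((cl_Omega - ?B) \<times> {x})"
    using sub by (intro emeasure_subadditive) auto
  also have "emeasure \<pi> (?B \<times> cl_Omega) = emeasure \<mu> ?B"
    by (rule fst_marginal) (rule half_ball_in_borel_Omega)
  finally have "emeasure \<nu> {x} - emeasure \<mu> ?B \<le> emeasure \<pi> ((cl_Omega - ?B) \<times> {x})"
    using \<nu> by (simp add: ennreal_minus_le_iff)
  then have "ennreal ((dist_bd x / 2) powr p) * (emeasure \<nu> {x} - emeasure \<mu> ?B)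
      \<le> ennreal ((dist_bd x / 2) powr p) * emeasure \<pi> ((cl_Omega - ?B) \<times> {x})"
    by (rule mult_left_mono) simp
  also have "\<dots> \<le> (\<integral>\<^sup>+ (y, z). ennreal (norm (y - z) powr p) \<partial>\<pi>)"
  proof (rule transport_cost_ge[OF \<pi>])
    fix y z assume y: "y \<in> cl_Omega - ?B" and z: "z \<in> {x}"
    show "dist_bd x / 2 \<le> dist y z"
      using y z dist_bd_pos[OF x] dist_bd_le_dist[OF x, of y] by (cases "y \<in> Omega") (auto simp: cl_Omega_def dist_commute)
  qed (use dist_bd_pos[OF x] \<open>0 < p\<close> sub in \<open>auto simp: sets_borel_cl_Omega_iff\<close>)
  finally show "ennreal ((dist_bd x / 2) powr p) * (emeasure \<nu> {x} - emeasure \<mu> ?B)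
      \<le> (\<integral>\<^sup>+ (y, z). ennreal (norm (y - z) powr p) \<partial>\<pi>)" .
qed

section \<open>Random point masses\<close>

text \<open>Membership is derived from the two values \<open>\<mu>(\<Omega> - {x})\<close> and \<open>\<mu>{x}\<close> alone, because
  these are measurable in \<open>\<mu>\<close>. Thus a random diagram is shown to lie almost surely in the class
  without any question about the measurability of the class itself.\<close>

lemma point_mass_in_MqLM:
  assumes x: "x \<in> Omega" "x \<in> A_ball L" and \<mu>: "sets \<mu> = sets borel_Omega"
    and conc: "emeasure \<mu> (Omega - {x}) = 0"
    and le: "emeasure \<mu> {x} \<le> ennreal m" and m: "0 \<le> m" "m * dist_bd x powr q \<le> M"
  shows "\<mu> \<in> MqLM q L M"
proof -
  have sx: "{x} \<in> sets \<mu>" "Omega - {x} \<in> sets \<mu>"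
    using x by (auto simp: \<mu> sets_borel_Omega_iff)
  have sp: "space \<mu> = Omega"
    using sets_eq_imp_space_eq[OF \<mu>] by (simp add: space_borel_Omega)
  have AE: "AE y in \<mu>. y = x"
    by (rule AE_I[where N = "Omega - {x}"]) (use conc sx sp in auto)
  have "Pers q \<mu> = (\<integral>\<^sup>+ y. ennreal (dist_bd x powr q) * indicator {x} y \<partial>\<mu>)"
    unfolding Pers_def using AE by (intro nn_integral_cong_AE) auto
  also have "\<dots> = ennreal (dist_bd x powr q) * emeasure \<mu> {x}"
    using sx by (simp add: nn_integral_cmult_indicator)
  also have "\<dots> \<le> ennreal (dist_bd x powr q) * ennreal m"
    by (intro mult_left_mono le) simp
  also have "\<dots> \<le> ennreal M"
    using m by (simp add: ennreal_mult[symmetric] mult.commute ennreal_leI)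
  finally have Pers: "Pers q \<mu> \<le> ennreal M" .
  have "emeasure \<mu> Omega = emeasure \<mu> {x}"
    using AE sx sp by (intro emeasure_eq_AE) (auto simp: \<mu> sets_borel_Omega_iff x)
  then have fin: "emeasure \<mu> Omega < \<infinity>"
    using le by (simp add: le_less_trans)
  have "emeasure \<mu> K < \<infinity>" if "K \<subseteq> Omega" for K
    using emeasure_mono[OF that, of \<mu>] fin sets.top[of \<mu>] by (simp add: sp le_less_trans)
  then have "radon_Omega \<mu>"
    by (simp add: radon_Omega_def \<mu>)
  moreover have "emeasure \<mu> (Omega - A_ball L) \<le> emeasure \<mu> (Omega - {x})"
    using x sx by (intro emeasure_mono) auto
  ultimately show ?thesis
    using Pers conc by (simp add: MqLM_def Mq_def le_less_trans)
qed

definition coin_diagram :: "real \<times> real \<Rightarrow> real \<Rightarrow> bool \<Rightarrow> (real \<times> real) measure" where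
  "coin_diagram x m b =
     (if b then scale_measure (ennreal m) (return borel_Omega x) else null_measure borel_Omega)"

definition coin_law :: "real \<times> real \<Rightarrow> real \<Rightarrow> (real \<times> real) measure measure" where
  "coin_law x m = distr (measure_pmf (bernoulli_pmf (1 / 2))) measure_algebra (coin_diagram x m)"

text \<open>The density of the law with success probability \<open>1/2 + \<epsilon>\<close> with respect to \<^const>\<open>coin_law\<close>,
  as a function of the diagram: the outcome of the coin is read off from the mass at \<open>x\<close>.\<close>

definition coin_ratio :: "real \<times> real \<Rightarrow> real \<Rightarrow> (real \<times> real) measure \<Rightarrow> ennreal" where
  "coin_ratio x \<epsilon> \<mu> = (if emeasure \<mu> {x} = 0 then ennreal (1 - 2 * \<epsilon>) else ennreal (1 + 2 * \<epsilon>))"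

context
  fixes x :: "real \<times> real" and m :: real
  assumes x: "x \<in> Omega" and m: "0 < m"
begin

lemma singleton_in_borel_Omega: "{x} \<in> sets borel_Omega" "Omega - {x} \<in> sets borel_Omega"
  using x by (auto simp: sets_borel_Omega_iff)

lemma emeasure_coin_diagram:
  "emeasure (coin_diagram x m b) {x} = (if b then ennreal m else 0)"
  "emeasure (coin_diagram x m b) (Omega - {x}) = 0"
  using singleton_in_borel_Omega by (auto simp: coin_diagram_def)

lemma measurable_coin_diagram [measurable]:
  "coin_diagram x m \<in> measurable (measure_pmf r) measure_algebra"
  by (auto simp: space_measure_algebra coin_diagram_def)

lemma sets_coin_law [simp, measurable_cong]: "sets (coin_law x m) = sets measure_algebra"
  by (simp add: coin_law_def)

lemma prob_space_coin_law: "prob_space (coin_law x m)"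
  unfolding coin_law_def by (intro prob_space.prob_space_distr measure_pmf.prob_space_axioms) measurable

lemma nn_integral_coin_law:
  assumes "h \<in> borel_measurable measure_algebra"
  shows "(\<integral>\<^sup>+ \<mu>. h \<mu> \<partial>coin_law x m) = h (coin_diagram x m True) / 2 + h (coin_diagram x m False) / 2"
proof -
  have half: "ennreal (1 / 2) = inverse 2"
    using divide_ennreal[of 1 2] by (simp add: divide_ennreal_def)
  show ?thesis
    using assms unfolding coin_law_def
    by (subst nn_integral_distr[OF measurable_coin_diagram])
      (simp_all add: nn_integral_bernoulli_pmf divide_ennreal_def half)
qed

lemma measurable_emeasure_singleton [measurable]:
  "(\<lambda>\<mu>. emeasure \<mu> {x}) \<in> borel_measurable measure_algebra"
  "(\<lambda>\<mu>. emeasure \<mu> (Omega - {x})) \<in> borel_measurable measure_algebra"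
  using singleton_in_borel_Omega by (auto intro: measurable_emeasure_measure_algebra)

lemma measurable_coin_ratio [measurable]: "coin_ratio x \<epsilon> \<in> borel_measurable measure_algebra"
  unfolding coin_ratio_def by measurable

lemma coin_ratio_coin_diagram:
  "coin_ratio x \<epsilon> (coin_diagram x m b) = ennreal (if b then 1 + 2 * \<epsilon> else 1 - 2 * \<epsilon>)"
  using m by (auto simp: coin_ratio_def emeasure_coin_diagram)

lemma moments_coin_ratio:
  assumes "0 \<le> \<epsilon>" "\<epsilon> \<le> 1 / 2"
  shows "(\<integral>\<^sup>+ \<mu>. coin_ratio x \<epsilon> \<mu> \<partial>coin_law x m) = 1"
    and "(\<integral>\<^sup>+ \<mu>. (coin_ratio x \<epsilon> \<mu>)\<^sup>2 \<partial>coin_law x m) = ennreal (1 + 4 * \<epsilon>\<^sup>2)"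
    and "(\<integral>\<^sup>+ \<mu>. coin_ratio x \<epsilon> \<mu> * emeasure \<mu> {x} \<partial>coin_law x m) = ennreal (m * (1 / 2 + \<epsilon>))"
proof -
  have half: "ennreal a / 2 = ennreal (a / 2)" if "0 \<le> a" for a
    using that by (simp flip: divide_ennreal)
  show "(\<integral>\<^sup>+ \<mu>. coin_ratio x \<epsilon> \<mu> \<partial>coin_law x m) = 1"
    using assms
    by (simp add: nn_integral_coin_law coin_ratio_coin_diagram half field_simps flip: ennreal_plus)
  show "(\<integral>\<^sup>+ \<mu>. (coin_ratio x \<epsilon> \<mu>)\<^sup>2 \<partial>coin_law x m) = ennreal (1 + 4 * \<epsilon>\<^sup>2)"
    (is "?I = _")
  proof -
    have "?I = ennreal ((1 + 2 * \<epsilon>)\<^sup>2 / 2) + ennreal ((1 - 2 * \<epsilon>)\<^sup>2 / 2)"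
      using assms by (simp add: nn_integral_coin_law coin_ratio_coin_diagram half ennreal_power
          del: ennreal_plus)
    also have "\<dots> = ennreal ((1 + 2 * \<epsilon>)\<^sup>2 / 2 + (1 - 2 * \<epsilon>)\<^sup>2 / 2)"
      by (rule ennreal_plus[symmetric]) auto
    also have "(1 + 2 * \<epsilon>)\<^sup>2 / 2 + (1 - 2 * \<epsilon>)\<^sup>2 / 2 = 1 + 4 * \<epsilon>\<^sup>2"
      by (simp add: power2_eq_square field_simps)
    finally show ?thesis .
  qed
  show "(\<integral>\<^sup>+ \<mu>. coin_ratio x \<epsilon> \<mu> * emeasure \<mu> {x} \<partial>coin_law x m) = ennreal (m * (1 / 2 + \<epsilon>))"
    using assms m
    by (simp add: nn_integral_coin_law coin_ratio_coin_diagram emeasure_coin_diagram half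
        algebra_simps add_divide_distrib flip: ennreal_plus ennreal_mult)
qed

lemma AE_coin_law_in_MqLM:
  assumes "x \<in> A_ball L" "m * dist_bd x powr q \<le> M"
  shows "AE \<mu> in coin_law x m. \<mu> \<in> MqLM q L M"
proof -
  have "AE \<mu> in coin_law x m. emeasure \<mu> (Omega - {x}) = 0 \<and> emeasure \<mu> {x} \<le> ennreal m"
    unfolding coin_law_def
    by (subst AE_distr_iff[OF measurable_coin_diagram]) (auto simp: emeasure_coin_diagram)
  then show ?thesis
  proof (rule AE_mp, intro AE_I2 impI)
    fix \<mu> assume "\<mu> \<in> space (coin_law x m)"
      and conc: "emeasure \<mu> (Omega - {x}) = 0 \<and> emeasure \<mu> {x} \<le> ennreal m"
    then have "sets \<mu> = sets borel_Omega"
      using sets_eq_imp_space_eq[OF sets_coin_law] by (simp add: space_measure_algebra)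
    then show "\<mu> \<in> MqLM q L M"
      using conc assms m x by (intro point_mass_in_MqLM[of x L \<mu> m]) auto
  qed
qed

lemma coin_law_in_PqLM:
  assumes "x \<in> A_ball L" "m * dist_bd x powr q \<le> M"
  shows "coin_law x m \<in> PqLM q L M"
  using assms by (simp add: PqLM_def prob_space_coin_law AE_coin_law_in_MqLM)

lemma biased_coin_law_in_PqLM:
  assumes "x \<in> A_ball L" "m * dist_bd x powr q \<le> M" and \<epsilon>: "0 \<le> \<epsilon>" "\<epsilon> \<le> 1 / 2"
  shows "density (coin_law x m) (coin_ratio x \<epsilon>) \<in> PqLM q L M"
proof -
  have "emeasure (density (coin_law x m) (coin_ratio x \<epsilon>)) (space (coin_law x m)) = 1"
    using moments_coin_ratio(1)[OF \<epsilon>] sets.top[of "coin_law x m"]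
    by (subst emeasure_density) (auto simp: nn_integral_set_ennreal cong: nn_integral_cong_simp)
  then have "prob_space (density (coin_law x m) (coin_ratio x \<epsilon>))"
    by (intro prob_spaceI) simp
  moreover have "AE \<mu> in density (coin_law x m) (coin_ratio x \<epsilon>). \<mu> \<in> MqLM q L M"
    using AE_coin_law_in_MqLM[OF assms(1,2)] by (subst AE_density) (auto elim: AE_mp)
  ultimately show ?thesis
    by (simp add: PqLM_def)
qed

lemma expected_diagram_coin_law:
  "emeasure (expected_diagram (coin_law x m)) {x} = ennreal (m / 2)"
  "emeasure (expected_diagram (coin_law x m)) (Omega - {x}) = 0"
proof -
  have "ennreal m / 2 = ennreal (m / 2)"
    using m by (simp flip: divide_ennreal)
  then show "emeasure (expected_diagram (coin_law x m)) {x} = ennreal (m / 2)"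
    by (simp add: emeasure_expected_diagram singleton_in_borel_Omega nn_integral_coin_law
        emeasure_coin_diagram)
  show "emeasure (expected_diagram (coin_law x m)) (Omega - {x}) = 0"
    by (simp add: emeasure_expected_diagram singleton_in_borel_Omega nn_integral_coin_law
        emeasure_coin_diagram)
qed

lemma expected_diagram_biased_coin_law:
  assumes "0 \<le> \<epsilon>" "\<epsilon> \<le> 1 / 2"
  shows "emeasure (expected_diagram (density (coin_law x m) (coin_ratio x \<epsilon>))) {x}
    = ennreal (m * (1 / 2 + \<epsilon>))"
  using assms
  by (simp add: emeasure_expected_diagram singleton_in_borel_Omega nn_integral_density
      moments_coin_ratio(3))

end

section \<open>The lower bound\<close>

lemma one_plus_quarter_power_le_two:
  assumes "1 \<le> n"
  shows "(1 + 1 / (4 * real n)) ^ n \<le> 2"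
proof -
  have "(1 + 1 / (4 * real n)) ^ n \<le> exp (1 / (4 * real n)) ^ n"
    by (intro power_mono) auto
  also have "\<dots> = exp (1 / 4)"
    using assms by (simp flip: exp_of_nat_mult)
  also have "\<dots> \<le> 2"
    using exp_bound[of "1 / 4"] by (simp add: power2_eq_square)
  finally show ?thesis .
qed

text \<open>Any point \<open>x\<close> of the ball yields a bound. The factor \<open>16\<close> collects the \<open>4\<close> from
  \<open>\<epsilon> = 1 / (4 \<surd>n)\<close>, a \<open>2\<close> from the overlap of the two laws, and a \<open>2\<close> from bounding the sum
  of the two risks by twice their supremum.\<close>

lemma minimax_rate_ge_point_mass:
  fixes m :: real
  assumes p: "0 < p" and n: "1 \<le> n" and x: "x \<in> Omega" "x \<in> A_ball L"
    and m: "0 < m" "m * dist_bd x powr q \<le> M"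
  shows "ennreal ((dist_bd x / 2) powr p * m / (16 * sqrt n)) \<le> minimax_rate p n (PqLM q L M)"
  unfolding minimax_rate_def
proof (rule INF_greatest)
  fix est assume "est \<in> estimators n"
  then have est: "est \<in> measurable (\<Pi>\<^sub>M i\<in>{..<n}. measure_algebra) measure_algebra"
    by (simp add: estimators_def)
  let ?risk = "\<lambda>P. \<integral>\<^sup>+ \<mu>s. epowr (OT p (est \<mu>s) (expected_diagram P)) p \<partial>(\<Pi>\<^sub>M i\<in>{..<n}. P)"
  let ?B = "ball x (dist_bd x / 2) \<inter> Omega"
  define \<epsilon> where "\<epsilon> = 1 / (4 * sqrt n)"
  define K where "K = ennreal ((dist_bd x / 2) powr p)"
  define T where "T = (\<lambda>\<mu>s. emeasure (est \<mu>s) ?B)"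
  define P\<^sub>0 where "P\<^sub>0 = coin_law x m"
  define P\<^sub>1 where "P\<^sub>1 = density P\<^sub>0 (coin_ratio x \<epsilon>)"
  define \<Delta> where "\<Delta> = ennreal ((dist_bd x / 2) powr p * (m * \<epsilon>))"
  have "1 \<le> sqrt n"
    using n by simp
  then have \<epsilon>: "0 \<le> \<epsilon>" "\<epsilon> \<le> 1 / 2"
    using frac_le[of 1 1 2 "4 * sqrt n"] by (simp_all add: \<epsilon>_def del: real_sqrt_ge_1_iff)
  have sets_P: "sets P\<^sub>0 = sets measure_algebra"
    using x m by (simp add: P\<^sub>0_def sets_coin_law)
  have T [measurable]: "T \<in> borel_measurable (\<Pi>\<^sub>M i\<in>{..<n}. P\<^sub>0)"
  proof -
    have "T \<in> borel_measurable (\<Pi>\<^sub>M i\<in>{..<n}. measure_algebra)"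
      unfolding T_def
      by (rule measurable_compose[OF est measurable_emeasure_measure_algebra])
        (rule half_ball_in_borel_Omega)
    then show ?thesis
      using measurable_cong_sets[OF sets_PiM_cong[OF refl sets_P] refl] by blast
  qed
  have risk0: "(\<integral>\<^sup>+ \<mu>s. K * (T \<mu>s - ennreal (m / 2)) \<partial>(\<Pi>\<^sub>M i\<in>{..<n}. P\<^sub>0)) \<le> ?risk P\<^sub>0"
    unfolding K_def T_def P\<^sub>0_def
    using OT_point_mass_ge_excess[OF p x(1) expected_diagram_coin_law(2)[OF x(1) m(1)]]
    by (intro nn_integral_mono) (simp add: expected_diagram_coin_law(1)[OF x(1) m(1)])
  have risk1: "(\<integral>\<^sup>+ \<mu>s. K * (ennreal (m * (1 / 2 + \<epsilon>)) - T \<mu>s) \<partial>(\<Pi>\<^sub>M i\<in>{..<n}. P\<^sub>1)) \<le> ?risk P\<^sub>1"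
    unfolding K_def T_def P\<^sub>1_def P\<^sub>0_def
    using OT_ge_deficit[OF p x(1)]
    by (intro nn_integral_mono) (metis expected_diagram_biased_coin_law[OF x(1) m(1) \<epsilon>] ennreal_neq_top infinity_ennreal_def)
  have "\<Delta> / 2 \<le> (\<integral>\<^sup>+ \<mu>s. K * (T \<mu>s - ennreal (m / 2)) \<partial>(\<Pi>\<^sub>M i\<in>{..<n}. P\<^sub>0))
      + (\<integral>\<^sup>+ \<mu>s. K * (ennreal (m * (1 / 2 + \<epsilon>)) - T \<mu>s) \<partial>(\<Pi>\<^sub>M i\<in>{..<n}. P\<^sub>1))"
    unfolding P\<^sub>1_def
  proof (rule nn_integral_two_point_lower_bound)
    show "prob_space P\<^sub>0"
      using x m by (simp add: P\<^sub>0_def prob_space_coin_law)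
    show "coin_ratio x \<epsilon> \<in> borel_measurable P\<^sub>0"
      using measurable_coin_ratio[OF x(1) m(1)] measurable_cong_sets[OF sets_P refl] by blast
    show "(\<integral>\<^sup>+ \<mu>. coin_ratio x \<epsilon> \<mu> \<partial>P\<^sub>0) = 1"
      unfolding P\<^sub>0_def by (rule moments_coin_ratio(1)[OF x(1) m(1) \<epsilon>])
    \<comment> \<open>The choice of \<open>\<epsilon>\<close>: the largest order at which the second moment stays bounded in \<open>n\<close>.\<close>
    have "4 * \<epsilon>\<^sup>2 = 1 / (4 * real n)"
      by (simp add: \<epsilon>_def power_divide power_mult_distrib)
    then show "(\<integral>\<^sup>+ \<mu>. (coin_ratio x \<epsilon> \<mu>)\<^sup>2 \<partial>P\<^sub>0) ^ n \<le> 2"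
      unfolding P\<^sub>0_def moments_coin_ratio(2)[OF x(1) m(1) \<epsilon>]
      using one_plus_quarter_power_le_two[OF n] ennreal_leI[of "(1 + 1 / (4 * real n)) ^ n" 2]
      by (simp add: ennreal_power del: ennreal_plus)
    fix \<mu>s
    have "ennreal (m * \<epsilon>) = ennreal (m * (1 / 2 + \<epsilon>)) - ennreal (m / 2)"
      using m \<epsilon> by (subst ennreal_minus) (auto simp: algebra_simps)
    also have "\<dots> \<le> (T \<mu>s - ennreal (m / 2)) + (ennreal (m * (1 / 2 + \<epsilon>)) - T \<mu>s)"
    proof (subst ennreal_minus_le_iff, intro conjI impI)
      have le: "a \<le> b + (a - b)" for a b :: ennreal
        using ennreal_minus_le_iff[of a b "a - b"] by simp
      have "ennreal (m * (1 / 2 + \<epsilon>)) \<le> T \<mu>s + (ennreal (m * (1 / 2 + \<epsilon>)) - T \<mu>s)"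
        by (rule le)
      also have "\<dots> \<le> (ennreal (m / 2) + (T \<mu>s - ennreal (m / 2))) + (ennreal (m * (1 / 2 + \<epsilon>)) - T \<mu>s)"
        by (intro add_right_mono le)
      finally show "ennreal (m * (1 / 2 + \<epsilon>))
          \<le> ennreal (m / 2) + ((T \<mu>s - ennreal (m / 2)) + (ennreal (m * (1 / 2 + \<epsilon>)) - T \<mu>s))"
        by (simp add: add.assoc)
    qed auto
    finally have "K * ennreal (m * \<epsilon>)
        \<le> K * ((T \<mu>s - ennreal (m / 2)) + (ennreal (m * (1 / 2 + \<epsilon>)) - T \<mu>s))"
      by (rule mult_left_mono) simp
    then show "\<Delta> \<le> K * (T \<mu>s - ennreal (m / 2)) + K * (ennreal (m * (1 / 2 + \<epsilon>)) - T \<mu>s)"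
      using m \<epsilon> by (simp add: \<Delta>_def K_def ennreal_mult distrib_left)
  qed measurable
  also have "\<dots> \<le> ?risk P\<^sub>0 + ?risk P\<^sub>1"
    by (intro add_mono risk0 risk1)
  also have "\<dots> \<le> (SUP P\<in>PqLM q L M. ?risk P) + (SUP P\<in>PqLM q L M. ?risk P)"
    unfolding P\<^sub>1_def P\<^sub>0_def
    by (intro add_mono SUP_upper coin_law_in_PqLM biased_coin_law_in_PqLM x m \<epsilon>)
  finally have "\<Delta> / 2 \<le> (SUP P\<in>PqLM q L M. ?risk P) * 2"
    by (simp add: mult_2_right)
  then have "\<Delta> / 2 / 2 \<le> (SUP P\<in>PqLM q L M. ?risk P) * 2 / 2"
    by (rule divide_right_mono_ennreal)
  also have "\<dots> = (SUP P\<in>PqLM q L M. ?risk P)"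
    by (rule ennreal_mult_divide_eq) simp_all
  also have "\<Delta> / 2 / 2 = ennreal ((dist_bd x / 2) powr p * m / (16 * sqrt n))"
    using m \<epsilon> by (simp add: \<Delta>_def \<epsilon>_def divide_ennreal flip: ennreal_numeral)
  finally show "ennreal ((dist_bd x / 2) powr p * m / (16 * sqrt n)) \<le> (SUP P\<in>PqLM q L M. ?risk P)" .
qed

theorem theorem2:
  fixes p q :: real
  assumes "1 \<le> p" and "0 \<le> q"
  shows "\<exists>c::real. c > 0 \<and>
    (\<forall>(L::real) (M::real) (n::nat). L > 0 \<longrightarrow> M > 0 \<longrightarrow> n \<ge> 1 \<longrightarrow>
       minimax_rate p n (PqLM q L M)
         \<ge> ennreal (c * M * L powr (p - q) * real n powr (- 1 / 2)))"
proof (intro exI conjI allI impI)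
  define c :: real where "c = (1 / 4) powr p * 2 powr q / 16"
  show "0 < c"
    by (simp add: c_def)
  fix L M :: real and n :: nat
  assume L: "L > 0" and M: "M > 0" and n: "n \<ge> 1"
  define x where "x = (- (L / sqrt 8), L / sqrt 8)"
  define m where "m = M / (L / 2) powr q"
  have x: "x \<in> Omega" "x \<in> A_ball L"
    using L by (auto simp: x_def Omega_def A_ball_def)
  have "sqrt 8 = 2 * sqrt 2"
    using real_sqrt_mult[of 4 2] by simp
  then have d: "dist_bd x = L / 2"
    by (simp add: dist_bd_def x_def)
  have "ennreal ((dist_bd x / 2) powr p * m / (16 * sqrt n)) \<le> minimax_rate p n (PqLM q L M)"
    using assms x L M n by (intro minimax_rate_ge_point_mass) (auto simp: m_def d)
  also have "(dist_bd x / 2) powr p * m / (16 * sqrt n)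
      = c * M * L powr (p - q) * real n powr (- 1 / 2)"
    using L M n
    by (simp add: d m_def c_def powr_divide powr_diff powr_minus powr_half_sqrt field_simps)
  finally show "ennreal (c * M * L powr (p - q) * real n powr (- 1 / 2))
      \<le> minimax_rate p n (PqLM q L M)" .
qed

end
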